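(* Let $d\ge 1$ and let $X$ and $X_{\mathbf n}$, $\mathbf n\in\mathbb Z_+^d$, be real-valued random variables on a probability space $(\Omega,\mathcal F,P)$ (no assumption is made on their dependence). Assume there is a constant $M>0$ such that $$\frac{1}{|\mathbf n|}\sum_{\mathbf k\preceq \mathbf n}P(|X_{\mathbf k}|>x)\le M\,P(|X|>x)\qquad\text{for all } x\ge 0 \text{ and all } \mathbf n\in\mathbb Z_+^d .$$ For a positive integer $n$ write $N=(n,\dots,n)\in\mathbb Z_+^d$, so $|N|=n^d$. If $E\big[|X|\log^+|X|\big]<\infty$, then for every $\epsilon>0$ and for almost all $t\in\mathbb T^d$ (with respect to Lebesgue measure), $$\sum_{n=1}^{\infty}|N|^{-1/d}\,P\Big(\max_{1\le m\le n}|S_{(m,\dots,m)}(t)|>\epsilon|N|\Big)<\infty .$$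
   Context: $\mathbb Z_+^d$ is the set of $d$-dimensional lattice points with positive integer coordinates. For $\mathbf k,\mathbf n\in\mathbb Z_+^d$, $\mathbf k\preceq\mathbf n$ means $k_i\le n_i$ for all $1\le i\le d$, and $|\mathbf n|=n_1n_2\cdots n_d$. $\mathbb T=[-\pi,\pi)$. For $t=(t_1,\dots,t_d)\in\mathbb T^d$, $\mathbf k\cdot t=k_1t_1+\cdots+k_dt_d$, and the discrete Fourier transform is $S_{\mathbf n}(t)=\sum_{\mathbf k\preceq\mathbf n}e^{i\mathbf k\cdot t}X_{\mathbf k}$; $S_{(m,\dots,m)}(t)$ is the cubic partial sum with all $d$ coordinates of the index equal to $m$. The notation $\log^+x$ means $\max\{1,\log x\}$ (equal to $1$ at $x=0$). *)

theory Defs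
  imports "HOL-Probability.Probability"
begin

text \<open>
  Multi-indices have type \<^typ>\<open>nat ^ 'd\<close>, with dimension \<^term>\<open>CARD('d)\<close>; the library
  order \<open>\<le>\<close> on this type is the coordinatewise one.
\<close>

definition pos_lattice :: "(nat ^ 'd) set" where
  "pos_lattice = {k. \<forall>i. 1 \<le> k $ i}"

definition index_size :: "nat ^ 'd \<Rightarrow> nat" where
  "index_size n = (\<Prod>i\<in>UNIV. n $ i)"

definition cubic :: "nat \<Rightarrow> nat ^ 'd" where
  "cubic m = (\<chi> i. m)"

definition index_box :: "nat ^ 'd \<Rightarrow> (nat ^ 'd) set" where
  "index_box n = {k \<in> pos_lattice. k \<le> n}"

definition torus :: "(real ^ 'd) set" where
  "torus = {t. \<forall>i. - pi \<le> t $ i \<and> t $ i < pi}"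

definition phase :: "nat ^ 'd \<Rightarrow> real ^ 'd \<Rightarrow> real" where
  "phase k t = (\<Sum>i\<in>UNIV. real (k $ i) * t $ i)"

definition DFT :: "(nat ^ 'd \<Rightarrow> 'w \<Rightarrow> real) \<Rightarrow> nat ^ 'd \<Rightarrow> real ^ 'd \<Rightarrow> 'w \<Rightarrow> complex" where
  "DFT Xs n t \<omega> = (\<Sum>k\<in>index_box n. exp (\<i> * complex_of_real (phase k t)) * complex_of_real (Xs k \<omega>))"

text \<open>Since \<open>ln 0 = 0\<close> in the library, this takes the value 1 at 0.\<close>

definition log_plus :: "real \<Rightarrow> real" where
  "log_plus x = max 1 (ln x)"

end

theory Submission
  imports Defs "HOL-Library.Discrete_Functions" "HOL-Real_Asymp.Real_Asymp"
begin

text \<open>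
  Truncate \<open>X\<^sub>k\<close> at \<open>A = n\<^sup>1\<^sup>/\<^sup>8\<close>. The discarded tails contribute at most a constant times
  \<open>(1/n) E[|X|; |X| > A]\<close> by Markov's inequality and domination, and
  \<open>\<Sum>\<^sub>n (1/n) E[|X|; |X| > n\<^sup>1\<^sup>/\<^sup>8]\<close> is at most a constant times \<open>E[|X| log\<^sup>+ |X|]\<close>. For the truncated variables no
  maximal inequality of Carleson type is needed: with \<open>r\<close> about \<open>\<surd>n\<close>, passing from \<open>m\<close> to the next
  smaller multiple of \<open>r\<close> changes the sum by at most \<open>d n\<^sup>d\<^sup>-\<^sup>1 r A = o(n\<^sup>d)\<close>, and over the
  \<open>O(\<surd>n)\<close> multiples of \<open>r\<close> a union bound with second moments suffices. Integrated over the torus,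
  orthogonality of the characters turns this into the convergent series \<open>\<Sum>\<^sub>n n\<^sup>-\<^sup>5\<^sup>/\<^sup>4\<close>.
\<close>

section \<open>Counting lattice points in cubes and shells\<close>

text \<open>Over \<open>UNIV\<close> extensionality is vacuous, so finiteness and cardinality of the
  box reduce to the known counts for \<open>PiE\<close>.\<close>

lemma index_box_cubic: "index_box (cubic m :: nat ^ 'd) = vec_lambda ` (UNIV \<rightarrow>\<^sub>E {1..m})"
proof (intro set_eqI iffI)
  fix k :: "nat ^ 'd"
  assume "k \<in> index_box (cubic m)"
  then have "($) k \<in> UNIV \<rightarrow>\<^sub>E {1..m}" "k = vec_lambda (($) k)"
    by (auto simp: index_box_def pos_lattice_def cubic_def less_eq_vec_def)
  then show "k \<in> vec_lambda ` (UNIV \<rightarrow>\<^sub>E {1..m})" by blast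
qed (auto simp: index_box_def pos_lattice_def cubic_def less_eq_vec_def PiE_iff)

lemma finite_index_box_cubic [simp]: "finite (index_box (cubic m :: nat ^ 'd))"
  by (simp add: index_box_cubic finite_PiE)

lemma card_index_box_cubic: "card (index_box (cubic m :: nat ^ 'd)) = m ^ CARD('d)"
proof -
  have "inj_on (vec_lambda :: _ \<Rightarrow> nat ^ 'd) (UNIV \<rightarrow>\<^sub>E {1..m})"
    by (auto simp: inj_on_def vec_lambda_inject)
  then show ?thesis by (simp add: index_box_cubic card_image card_PiE)
qed

lemma index_size_cubic: "index_size (cubic m :: nat ^ 'd) = m ^ CARD('d)"
  by (simp add: index_size_def cubic_def)

lemma index_box_cubic_mono:
  "m \<le> n \<Longrightarrow> index_box (cubic m :: nat ^ 'd) \<subseteq> index_box (cubic n)"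
  by (auto simp: index_box_def cubic_def less_eq_vec_def intro: order_trans)

text \<open>Extracting the factor \<open>b - a\<close> leaves \<open>d\<close> products of total
  degree \<open>d - 1\<close> in \<open>a\<close> and \<open>b\<close>, each at most
  \<open>b ^ (d - 1)\<close>.\<close>

lemma power_diff_le:
  fixes a b :: real
  assumes "0 \<le> a" "a \<le> b"
  shows "b ^ d - a ^ d \<le> real d * (b - a) * b ^ (d - 1)"
proof -
  have "(\<Sum>i<d. b ^ (d - Suc i) * a ^ i) \<le> (\<Sum>i<d. b ^ (d - 1))"
  proof (rule sum_mono)
    fix i assume i: "i \<in> {..<d}"
    have "b ^ (d - Suc i) * a ^ i \<le> b ^ (d - Suc i) * b ^ i"
      using assms by (intro mult_left_mono power_mono) auto
    also have "\<dots> = b ^ (d - 1)"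
      using i by (simp flip: power_add)
    finally show "b ^ (d - Suc i) * a ^ i \<le> b ^ (d - 1)" .
  qed
  then have "(b - a) * (\<Sum>i<d. b ^ (d - Suc i) * a ^ i) \<le> (b - a) * (real d * b ^ (d - 1))"
    using assms by (intro mult_left_mono) auto
  moreover have "b ^ d - a ^ d = (b - a) * (\<Sum>i<d. b ^ (d - Suc i) * a ^ i)"
    using power_diff_sumr2[of a d b] by (metis minus_diff_eq mult_minus_left)
  ultimately show ?thesis by (simp add: mult_ac)
qed

text \<open>The cost of rounding \<open>m\<close> down to \<open>g\<close>: the count
  \<open>m^d - g^d\<close> is one power of \<open>n\<close> smaller than a full box, with the gap
  \<open>r\<close> as an extra factor.\<close>

lemma card_index_box_shell:
  assumes "g \<le> m" "m \<le> n" "m \<le> g + r"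
  shows "real (card (index_box (cubic m :: nat ^ 'd) - index_box (cubic g)))
           \<le> real CARD('d) * real n ^ (CARD('d) - 1) * real r"
proof -
  let ?d = "CARD('d)"
  have "real (card (index_box (cubic m :: nat ^ 'd) - index_box (cubic g))) = real m ^ ?d - real g ^ ?d"
    using index_box_cubic_mono[OF \<open>g \<le> m\<close>, where 'd = 'd] power_mono[OF \<open>g \<le> m\<close>, of ?d]
    by (simp add: card_Diff_subset card_index_box_cubic of_nat_diff)
  also have "\<dots> \<le> real ?d * (real m - real g) * real m ^ (?d - 1)"
    using assms by (intro power_diff_le) auto
  also have "\<dots> \<le> real ?d * real r * real n ^ (?d - 1)"
    using assms by (intro mult_mono power_mono) auto
  finally show ?thesis by (simp add: mult_ac)
qed

section \<open>Tail expectations under domination of tail probabilities\<close>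

text \<open>Write \<open>|X|\<close> as the length of \<open>{0..<|X|}\<close> and exchange the
  integrals. The level \<open>max A x\<close> merges the conditions \<open>A < |X|\<close> and
  \<open>x < |X|\<close>, so that only tail probabilities of \<open>X\<close> remain.\<close>

lemma nn_integral_layer_cake:
  assumes "sigma_finite_measure M" and [measurable]: "X \<in> borel_measurable M" and A: "A \<ge> 0"
  shows "(\<integral>\<^sup>+\<omega>. ennreal \<bar>X \<omega>\<bar> * indicator {\<omega>. A < \<bar>X \<omega>\<bar>} \<omega> \<partial>M)
     = (\<integral>\<^sup>+x. indicator {0..} x * emeasure M {\<omega> \<in> space M. max A x < \<bar>X \<omega>\<bar>} \<partial>lborel)"
proof -
  interpret sigma_finite_measure M by fact
  interpret pair_sigma_finite M lborel ..
  have eq: "ennreal \<bar>X \<omega>\<bar> * indicator {\<omega>. A < \<bar>X \<omega>\<bar>} \<omega>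
          = (\<integral>\<^sup>+x. indicator {0..} x * indicator {x. max A x < \<bar>X \<omega>\<bar>} x \<partial>lborel)" for \<omega>
  proof -
    have "(\<integral>\<^sup>+x. indicator {0..} x * indicator {x. max A x < \<bar>X \<omega>\<bar>} x \<partial>lborel)
        = (\<integral>\<^sup>+x. indicator (if A < \<bar>X \<omega>\<bar> then {0..<\<bar>X \<omega>\<bar>} else {}) x \<partial>lborel)"
      by (intro nn_integral_cong) (auto simp: indicator_def)
    also have "\<dots> = ennreal \<bar>X \<omega>\<bar> * indicator {\<omega>. A < \<bar>X \<omega>\<bar>} \<omega>"
      by auto
    finally show ?thesis by simp
  qed
  have "(\<integral>\<^sup>+\<omega>. ennreal \<bar>X \<omega>\<bar> * indicator {\<omega>. A < \<bar>X \<omega>\<bar>} \<omega> \<partial>M)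
      = (\<integral>\<^sup>+x. \<integral>\<^sup>+\<omega>. indicator {0..} x * indicator {x. max A x < \<bar>X \<omega>\<bar>} x \<partial>M \<partial>lborel)"
    unfolding eq by (rule Fubini'[symmetric]) (simp add: indicator_def case_prod_unfold, measurable)
  also have "\<dots> = (\<integral>\<^sup>+x. indicator {0..} x * emeasure M {\<omega> \<in> space M. max A x < \<bar>X \<omega>\<bar>} \<partial>lborel)"
  proof (intro nn_integral_cong)
    fix x :: real
    have "(\<integral>\<^sup>+\<omega>. indicator {0..} x * indicator {x. max A x < \<bar>X \<omega>\<bar>} x \<partial>M)
        = (\<integral>\<^sup>+\<omega>. indicator {0..} x * indicator {\<omega> \<in> space M. max A x < \<bar>X \<omega>\<bar>} \<omega> \<partial>M)"
      by (intro nn_integral_cong) (auto simp: indicator_def)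
    then show "(\<integral>\<^sup>+\<omega>. indicator {0..} x * indicator {x. max A x < \<bar>X \<omega>\<bar>} x \<partial>M)
        = indicator {0..} x * emeasure M {\<omega> \<in> space M. max A x < \<bar>X \<omega>\<bar>}"
      by (simp add: nn_integral_cmult)
  qed
  finally show ?thesis .
qed

text \<open>The layer cake formula turns both sides into integrals over \<open>x\<close> of tail
  probabilities at level \<open>max A x\<close>, where \<open>dom\<close> compares the
  integrands.\<close>

lemma (in prob_space) sum_tail_expectation_le:
  assumes [measurable]: "X \<in> borel_measurable M" "\<And>k. k \<in> K \<Longrightarrow> Y k \<in> borel_measurable M"
    and "A \<ge> 0" "C \<ge> 0"
    and dom: "\<And>x. x \<ge> 0 \<Longrightarrow> (\<Sum>k\<in>K. prob {\<omega> \<in> space M. \<bar>Y k \<omega>\<bar> > x})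
                             \<le> C * prob {\<omega> \<in> space M. \<bar>X \<omega>\<bar> > x}"
  shows "(\<Sum>k\<in>K. \<integral>\<^sup>+\<omega>. ennreal \<bar>Y k \<omega>\<bar> * indicator {\<omega>. A < \<bar>Y k \<omega>\<bar>} \<omega> \<partial>M)
    \<le> ennreal C * (\<integral>\<^sup>+\<omega>. ennreal \<bar>X \<omega>\<bar> * indicator {\<omega>. A < \<bar>X \<omega>\<bar>} \<omega> \<partial>M)"
proof -
  have sf: "sigma_finite_measure M" ..
  have [measurable]: "(\<lambda>x. emeasure M {\<omega> \<in> space M. max A x < \<bar>Z \<omega>\<bar>}) \<in> borel_measurable borel"
    if [measurable]: "Z \<in> borel_measurable M" for Z
    by measurable
  have "(\<Sum>k\<in>K. \<integral>\<^sup>+\<omega>. ennreal \<bar>Y k \<omega>\<bar> * indicator {\<omega>. A < \<bar>Y k \<omega>\<bar>} \<omega> \<partial>M)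
      = (\<Sum>k\<in>K. \<integral>\<^sup>+x. indicator {0..} x * emeasure M {\<omega> \<in> space M. max A x < \<bar>Y k \<omega>\<bar>} \<partial>lborel)"
    using assms by (intro sum.cong nn_integral_layer_cake[OF sf]) auto
  also have "\<dots> = (\<integral>\<^sup>+x. (\<Sum>k\<in>K. indicator {0..} x * emeasure M {\<omega> \<in> space M. max A x < \<bar>Y k \<omega>\<bar>}) \<partial>lborel)"
    by (rule nn_integral_sum[symmetric]) measurable
  also have "\<dots> \<le> (\<integral>\<^sup>+x. ennreal C * (indicator {0..} x * emeasure M {\<omega> \<in> space M. max A x < \<bar>X \<omega>\<bar>}) \<partial>lborel)"
  proof (intro nn_integral_mono)
    fix x :: real
    show "(\<Sum>k\<in>K. indicator {0..} x * emeasure M {\<omega> \<in> space M. max A x < \<bar>Y k \<omega>\<bar>})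
      \<le> ennreal C * (indicator {0..} x * emeasure M {\<omega> \<in> space M. max A x < \<bar>X \<omega>\<bar>})"
      using dom[of "max A x"] \<open>A \<ge> 0\<close> \<open>C \<ge> 0\<close>
      by (auto simp: indicator_def emeasure_eq_measure simp flip: ennreal_mult intro!: ennreal_leI)
  qed
  also have "\<dots> = ennreal C * (\<integral>\<^sup>+\<omega>. ennreal \<bar>X \<omega>\<bar> * indicator {\<omega>. A < \<bar>X \<omega>\<bar>} \<omega> \<partial>M)"
    using \<open>A \<ge> 0\<close> by (simp add: nn_integral_layer_cake[OF sf] nn_integral_cmult)
  finally show ?thesis .
qed

section \<open>The logarithmic moment and the series of tails\<close>

lemma harm_le_ln: "n \<ge> 1 \<Longrightarrow> harm n \<le> 1 + ln (real n)"
proof (induction n rule: nat_induct_at_least)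
  case (Suc n)
  \<comment> \<open>The bound \<open>ln u \<le> u - 1\<close> at \<open>u = n / (n + 1)\<close>,
    with signs reversed.\<close>
  have "1 / real (Suc n) \<le> ln (real (Suc n)) - ln (real n)"
    using Suc.hyps ln_le_minus_one[of "real n / real (Suc n)"] by (simp add: ln_div field_simps)
  then show ?case using Suc by (simp add: harm_Suc inverse_eq_divide)
qed (simp add: harm_def)

text \<open>For \<open>y > 1\<close> the condition means \<open>n < y powr (1 / \<alpha>)\<close>,
  so the sum is a partial harmonic sum of size at most \<open>1 + ln y / \<alpha>\<close>;
  \<open>log_plus y\<close> dominates both \<open>1\<close> and \<open>ln y\<close>.\<close>

lemma suminf_harmonic_below_le:
  assumes "\<alpha> > 0"
  shows "(\<Sum>n. ennreal (1 / real n) * indicator {n. real n powr \<alpha> < y} n)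
           \<le> ennreal ((1 + 1 / \<alpha>) * log_plus y)"
proof (cases "y \<le> 1")
  case True
  \<comment> \<open>No \<open>n \<ge> 1\<close> satisfies the condition, and the term at
    \<open>n = 0\<close> vanishes because \<open>1 / 0 = 0\<close>.\<close>
  have "ennreal (1 / real n) * indicator {n. real n powr \<alpha> < y} n = 0" for n
    using True ge_one_powr_ge_zero[of "real n" \<alpha>] assms by (cases "n = 0") (auto simp: indicator_def)
  then show ?thesis by (simp del: mult_eq_0_iff)
next
  case False
  define N where "N = nat \<lfloor>y powr (1 / \<alpha>)\<rfloor>"
  have N: "1 \<le> N" "real N \<le> y powr (1 / \<alpha>)"
    using False assms by (auto simp: N_def le_nat_floor ge_one_powr_ge_zero)
  have le_N: "n \<le> N" if "real n powr \<alpha> < y" for n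
  proof -
    have "real n = (real n powr \<alpha>) powr (1 / \<alpha>)"
      using assms by (simp add: powr_powr)
    also have "\<dots> \<le> y powr (1 / \<alpha>)"
      using that assms by (intro powr_mono2) auto
    finally show ?thesis by (simp add: N_def le_nat_floor)
  qed
  have "(\<Sum>n<m. ennreal (1 / real n) * indicator {n. real n powr \<alpha> < y} n)
           \<le> ennreal ((1 + 1 / \<alpha>) * log_plus y)" for m
  proof -
    have "(\<Sum>n<m. ennreal (1 / real n) * indicator {n. real n powr \<alpha> < y} n)
        = ennreal (\<Sum>n<m. 1 / real n * indicator {n. real n powr \<alpha> < y} n)"
    proof -
      have "ennreal (1 / real n) * indicator {n. real n powr \<alpha> < y} n
          = ennreal (1 / real n * indicator {n. real n powr \<alpha> < y} n)" for n
        by (simp add: indicator_def)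
      then show ?thesis by (simp only:) (rule sum_ennreal, simp)
    qed
    also have "(\<Sum>n<m. 1 / real n * indicator {n. real n powr \<alpha> < y} n)
        = (\<Sum>n | n < m \<and> real n powr \<alpha> < y. 1 / real n)"
      by (intro sum.mono_neutral_cong_right) (auto simp: indicator_def)
    \<comment> \<open>Index 0 meets the condition, since \<open>0 powr \<alpha> = 0 < y\<close>, but
      its term is \<open>1 / 0 = 0\<close>.\<close>
    also have "\<dots> \<le> (\<Sum>n\<in>insert 0 {1..N}. 1 / real n)"
      using le_N by (intro sum_mono2) (auto simp: Suc_le_eq)
    also have "\<dots> = harm N"
      by (simp add: harm_def inverse_eq_divide)
    also have "\<dots> \<le> 1 + ln (real N)"
      by (rule harm_le_ln) (rule N)
    also have "\<dots> \<le> 1 + ln (y powr (1 / \<alpha>))"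
      using N by (intro add_left_mono ln_mono) auto
    also have "\<dots> = 1 + 1 / \<alpha> * ln y"
      using False by (simp add: ln_powr)
    also have "\<dots> \<le> 1 * log_plus y + 1 / \<alpha> * log_plus y"
      using assms by (intro add_mono mult_left_mono) (auto simp: log_plus_def)
    finally show ?thesis by (simp add: ring_distribs ennreal_leI)
  qed
  then show ?thesis by (intro suminf_le_const) auto
qed

text \<open>By Tonelli the sum moves inside the integral; for fixed \<open>\<omega>\<close> it is
  \<open>|X \<omega>|\<close> times a harmonic sum over
  \<open>n powr \<alpha> < |X \<omega>|\<close>, which produces the factor
  \<open>log_plus\<close>.\<close>

lemma nn_integral_log_tail_finite:
  assumes [measurable]: "X \<in> borel_measurable M" and "\<alpha> > 0"
    and int: "integrable M (\<lambda>\<omega>. \<bar>X \<omega>\<bar> * log_plus \<bar>X \<omega>\<bar>)"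
  shows "(\<Sum>n. ennreal (1 / real n) * (\<integral>\<^sup>+\<omega>. ennreal \<bar>X \<omega>\<bar> * indicator {\<omega>. real n powr \<alpha> < \<bar>X \<omega>\<bar>} \<omega> \<partial>M)) < \<infinity>"
proof -
  have "(\<Sum>n. ennreal (1 / real n) * (\<integral>\<^sup>+\<omega>. ennreal \<bar>X \<omega>\<bar> * indicator {\<omega>. real n powr \<alpha> < \<bar>X \<omega>\<bar>} \<omega> \<partial>M))
      = (\<integral>\<^sup>+\<omega>. (\<Sum>n. ennreal (1 / real n) * (ennreal \<bar>X \<omega>\<bar> * indicator {\<omega>. real n powr \<alpha> < \<bar>X \<omega>\<bar>} \<omega>)) \<partial>M)"
    by (subst nn_integral_suminf) (auto simp: nn_integral_cmult)
  also have "\<dots> \<le> (\<integral>\<^sup>+\<omega>. ennreal (1 + 1 / \<alpha>) * ennreal (\<bar>X \<omega>\<bar> * log_plus \<bar>X \<omega>\<bar>) \<partial>M)"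
  proof (intro nn_integral_mono)
    fix \<omega>
    have "(\<Sum>n. ennreal (1 / real n) * (ennreal \<bar>X \<omega>\<bar> * indicator {\<omega>. real n powr \<alpha> < \<bar>X \<omega>\<bar>} \<omega>))
      = ennreal \<bar>X \<omega>\<bar> * (\<Sum>n. ennreal (1 / real n) * indicator {n. real n powr \<alpha> < \<bar>X \<omega>\<bar>} n)"
      by (subst ennreal_suminf_cmult[symmetric]) (auto simp: indicator_def mult_ac intro!: arg_cong[where f = suminf])
    also have "\<dots> \<le> ennreal \<bar>X \<omega>\<bar> * ennreal ((1 + 1 / \<alpha>) * log_plus \<bar>X \<omega>\<bar>)"
      by (intro mult_left_mono suminf_harmonic_below_le assms) auto
    also have "\<dots> = ennreal (1 + 1 / \<alpha>) * ennreal (\<bar>X \<omega>\<bar> * log_plus \<bar>X \<omega>\<bar>)"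
      using assms by (subst (1 2) ennreal_mult[symmetric]) (auto simp: log_plus_def mult_ac)
    finally show "(\<Sum>n. ennreal (1 / real n) * (ennreal \<bar>X \<omega>\<bar> * indicator {\<omega>. real n powr \<alpha> < \<bar>X \<omega>\<bar>} \<omega>)) \<le> \<dots>" .
  qed
  also have "\<dots> = ennreal (1 + 1 / \<alpha>) * (\<integral>\<^sup>+\<omega>. ennreal (\<bar>X \<omega>\<bar> * log_plus \<bar>X \<omega>\<bar>) \<partial>M)"
    using int by (intro nn_integral_cmult) auto
  also have "\<dots> < \<infinity>"
    using int assms by (auto simp: ennreal_mult_less_top nn_integral_eq_integral log_plus_def)
  finally show ?thesis .
qed

section \<open>Orthogonality of characters on the torus\<close>

lemma torus_eq: "torus = {t :: real ^ 'd. \<forall>b\<in>Basis. t \<bullet> b \<in> {- pi..<pi}}"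
  by (auto simp: torus_def Basis_vec_def inner_axis)

lemma torus_measurable [measurable]: "torus \<in> sets (borel :: (real ^ 'd) measure)"
  unfolding torus_def by measurable

lemma emeasure_torus_finite: "emeasure lborel (torus :: (real ^ 'd) set) < \<infinity>"
proof -
  have "emeasure lborel (torus :: (real ^ 'd) set) \<le> emeasure lborel (cbox (\<chi> i. - pi) (\<chi> i. pi) :: (real ^ 'd) set)"
    by (intro emeasure_mono) (auto simp: torus_def mem_box_cart less_imp_le)
  also have "\<dots> < \<infinity>" by (simp add: emeasure_lborel_cbox_eq)
  finally show ?thesis .
qed

text \<open>A nonzero integer frequency has an antiderivative with equal values at \<open>pi\<close>
  and \<open>- pi\<close>; frequency 0 yields the length of the interval.\<close>

lemma integral_cis_period:
  fixes m :: int
  shows "has_bochner_integral lborel (\<lambda>x. indicator {- pi..<pi} x *\<^sub>R cis (of_int m * x))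
           (if m = 0 then of_real (2 * pi) else 0)"
proof -
  \<comment> \<open>For \<open>m = 0\<close> the quotient would divide by zero, so the
    antiderivative of the constant 1 is used there.\<close>
  define F where "F = (\<lambda>x. if m = 0 then complex_of_real x else cis (of_int m * x) / (\<i> * of_int m))"
  have F: "F pi - F (- pi) = (if m = 0 then of_real (2 * pi) else 0)"
  proof -
    have "cis (of_int m * pi) = cis (of_int m * (- pi))"
      using sin_npi_int[of m] by (simp add: complex_eq_iff mult.commute)
    then show ?thesis by (auto simp: F_def)
  qed
  have "(F has_vector_derivative cis (of_int m * x)) (at x within S)" for x S
  proof -
    \<comment> \<open>The derivative is computed in a complex variable first and then restricted to
      the real line.\<close>
    have "((\<lambda>z. if m = 0 then z else exp (\<i> * of_int m * z) / (\<i> * of_int m))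
        has_field_derivative exp (\<i> * of_int m * of_real x)) (at (of_real x))"
      by (cases "m = 0") (auto intro!: derivative_eq_intros)
    from has_vector_derivative_real_field[OF this, of S] show ?thesis
      by (simp add: F_def cis_conv_exp mult.assoc cong: if_cong)
  qed
  then have "has_bochner_integral lborel (\<lambda>x. indicator {- pi..pi} x *\<^sub>R cis (of_int m * x)) (F pi - F (- pi))"
    by (intro has_bochner_integral_FTC_Icc) (auto intro!: continuous_intros)
  then show ?thesis
    unfolding F
    \<comment> \<open>The fundamental theorem covers the closed interval; dropping the endpoint
      \<open>pi\<close> changes only a null set.\<close>
    by (rule has_bochner_integralI_AE)
      (use AE_lborel_singleton[of pi] in \<open>auto simp: indicator_def cis_conv_exp\<close>)
qed

text \<open>The integrand is a product of functions of single coordinates, so the integral is a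
  product of one-dimensional ones; if \<open>k \<noteq> l\<close>, some coordinate has nonzero
  integer frequency and its factor is zero.\<close>

lemma integral_character_torus:
  fixes k l :: "nat ^ 'd"
  shows "(\<integral>t. indicator torus t *\<^sub>R cis (phase k t - phase l t) \<partial>lborel)
           = (if k = l then of_real ((2 * pi) ^ CARD('d)) else 0)"
proof -
  \<comment> \<open>Frequencies are subtracted as reals, since subtraction in \<open>nat\<close>
    would cut off at zero.\<close>
  define v :: "real ^ 'd" where "v = (\<chi> i. real (k $ i) - real (l $ i))"
  define g where "g = (\<lambda>b x. indicator {- pi..<pi} x *\<^sub>R cis ((v \<bullet> b) * x))"
  have int: "\<exists>m::int. v \<bullet> b = of_int m" if b: "b \<in> Basis" for b
  proof -
    obtain i where "b = axis i 1" using b by (auto simp: Basis_vec_def)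
    then have "v \<bullet> b = of_int (int (k $ i) - int (l $ i))" by (simp add: v_def inner_axis)
    then show ?thesis by blast
  qed
  interpret product_sigma_finite "\<lambda>_. lborel :: real measure" ..
  have g: "indicator torus t *\<^sub>R cis (phase k t - phase l t) = (\<Prod>b\<in>Basis. g b (t \<bullet> b))" for t :: "real ^ 'd"
  proof -
    have "phase k t - phase l t = v \<bullet> t"
      by (simp add: phase_def v_def inner_vec_def sum_subtractf left_diff_distrib)
    then have "phase k t - phase l t = (\<Sum>b\<in>Basis. (v \<bullet> b) * (t \<bullet> b))"
      using euclidean_inner[of v t] by simp
    moreover have "cis (\<Sum>b\<in>B. f b) = (\<Prod>b\<in>B. cis (f b))" for f and B :: "(real ^ 'd) set"
      by (induction B rule: infinite_finite_induct) (auto simp: cis_mult[symmetric])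
    moreover have "(indicator torus t :: complex) = (\<Prod>b\<in>Basis. indicator {- pi..<pi} (t \<bullet> b))"
      unfolding torus_eq by (simp add: indicator_def prod.If_cases) 
    ultimately show ?thesis
      by (simp add: g_def scaleR_conv_of_real prod.distrib of_real_indicator)
  qed
  have meas [measurable]: "g b \<in> borel_measurable borel" for b
    unfolding g_def cis_conv_exp by measurable
  have I: "has_bochner_integral lborel (g b) (if v \<bullet> b = 0 then of_real (2 * pi) else 0)" if b: "b \<in> Basis" for b
  proof -
    obtain m :: int where "v \<bullet> b = of_int m" using int[OF b] by blast
    then show ?thesis using integral_cis_period[of m] by (simp only: g_def of_int_eq_0_iff)
  qed
  \<comment> \<open>\<open>lborel_eq\<close> presents Lebesgue measure as the image of a product
    measure indexed by \<open>Basis\<close>, which opens the way to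
    \<open>product_integral_prod\<close>.\<close>
  have "(\<integral>t. indicator torus t *\<^sub>R cis (phase k t - phase l t) \<partial>lborel)
      = (\<integral>t. (\<Prod>b\<in>Basis. g b (t \<bullet> b))
          \<partial>distr (\<Pi>\<^sub>M b\<in>Basis. lborel) borel (\<lambda>f. \<Sum>b\<in>(Basis :: (real ^ 'd) set). f b *\<^sub>R b))"
    unfolding g by (rule arg_cong[OF lborel_eq])
  also have "\<dots> = (\<integral>f. (\<Prod>b\<in>Basis. g b ((\<Sum>b\<in>(Basis :: (real ^ 'd) set). f b *\<^sub>R b) \<bullet> b))
          \<partial>(\<Pi>\<^sub>M b\<in>Basis. lborel))"
    by (intro integral_distr) measurable
  also have "\<dots> = (\<integral>f. (\<Prod>b\<in>Basis. g b (f b)) \<partial>(\<Pi>\<^sub>M b\<in>(Basis :: (real ^ 'd) set). lborel))"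
    by (intro Bochner_Integration.integral_cong prod.cong) (simp_all add: inner_sum_left_Basis)
  also have "\<dots> = (\<Prod>b\<in>Basis. if v \<bullet> b = 0 then of_real (2 * pi) else 0)"
    using I by (subst product_integral_prod)
      (auto simp: has_bochner_integral_iff intro!: prod.cong)
  also have "\<dots> = (if k = l then of_real ((2 * pi) ^ CARD('d)) else 0)"
  proof (cases "k = l")
    case True
    then have "v = 0" by (simp add: v_def vec_eq_iff)
    with True show ?thesis by simp
  next
    case False
    then have "v \<noteq> 0" by (auto simp: v_def vec_eq_iff)
    then obtain b where "b \<in> Basis" "v \<bullet> b \<noteq> 0"
      using euclidean_all_zero_iff[of v] by blast
    with False show ?thesis by (auto intro!: prod_zero)
  qed
  finally show ?thesis .
qed

section \<open>Second moments of random trigonometric polynomials\<close>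

text \<open>Expand \<open>z * cnj z\<close> and take real parts. The cosine form keeps the
  expectations and torus integrals that follow real-valued.\<close>

lemma norm_sum_cis_squared:
  "(cmod (\<Sum>k\<in>K. cis (\<theta> k) * of_real (y k)))\<^sup>2 = (\<Sum>k\<in>K. \<Sum>l\<in>K. cos (\<theta> k - \<theta> l) * (y k * y l))"
proof -
  have "complex_of_real ((cmod (\<Sum>k\<in>K. cis (\<theta> k) * of_real (y k)))\<^sup>2)
      = (\<Sum>k\<in>K. cis (\<theta> k) * of_real (y k)) * cnj (\<Sum>k\<in>K. cis (\<theta> k) * of_real (y k))"
    by (rule complex_norm_square)
  also have "\<dots> = (\<Sum>k\<in>K. \<Sum>l\<in>K. cis (\<theta> k - \<theta> l) * of_real (y k * y l))"
  proof -
    have "cis (a - b) = cis a * cis (- b)" for a b by (simp add: cis_mult)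
    then show ?thesis by (simp add: sum_product cis_cnj mult_ac)
  qed
  finally show ?thesis
    by (subst (asm) complex_eq_iff) (simp add: Re_sum)
qed

text \<open>Real part of the orthogonality relation. Integrability needs its own argument, since the
  value of a Bochner integral does not provide it: the integrand is bounded on a set of finite
  measure.\<close>

lemma integral_cos_torus:
  fixes k l :: "nat ^ 'd"
  shows "has_bochner_integral lborel (\<lambda>t. indicator torus t * cos (phase k t - phase l t))
           (if k = l then (2 * pi) ^ CARD('d) else 0)"
proof -
  have "continuous_on UNIV (\<lambda>t. cis (phase k t - phase l t))"
    unfolding phase_def cis_conv_exp by (intro continuous_intros)
  then have "integrable lborel (\<lambda>t. indicator torus t *\<^sub>R cis (phase k t - phase l t))"
    using emeasure_torus_finite[where 'd = 'd]
    by (intro integrableI_bounded_set_indicator[where B = 1]) (auto intro: borel_measurable_continuous_onI)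
  then have "has_bochner_integral lborel (\<lambda>t. indicator torus t *\<^sub>R cis (phase k t - phase l t))
      (if k = l then of_real ((2 * pi) ^ CARD('d)) else 0)"
    by (simp add: has_bochner_integral_iff integral_character_torus)
  from has_bochner_integral_Re[OF this] show ?thesis
    by (simp add: if_distrib cong: if_cong)
qed

context prob_space
begin

lemma expectation_trig_poly_squared:
  assumes "\<And>k. k \<in> K \<Longrightarrow> Y k \<in> borel_measurable M"
    and "\<And>k \<omega>. k \<in> K \<Longrightarrow> \<bar>Y k \<omega>\<bar> \<le> A"
  shows "has_bochner_integral M (\<lambda>\<omega>. (cmod (\<Sum>k\<in>K. cis (\<theta> k) * of_real (Y k \<omega>)))\<^sup>2)
           (\<Sum>k\<in>K. \<Sum>l\<in>K. cos (\<theta> k - \<theta> l) * expectation (\<lambda>\<omega>. Y k \<omega> * Y l \<omega>))"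
proof -
  have "integrable M (\<lambda>\<omega>. Y k \<omega> * Y l \<omega>)" if kl: "k \<in> K" "l \<in> K" for k l
  proof (rule integrable_const_bound[where B = "A * A"])
    have "A \<ge> 0" using order_trans[OF abs_ge_zero assms(2)[OF kl(1)]] .
    then show "AE \<omega> in M. norm (Y k \<omega> * Y l \<omega>) \<le> A * A"
      using assms(2)[OF kl(1)] assms(2)[OF kl(2)] by (simp add: abs_mult mult_mono)
  qed (use assms(1) kl in measurable)
  then show ?thesis
    unfolding norm_sum_cis_squared
    by (intro has_bochner_integral_sum has_bochner_integral_mult_right has_bochner_integral_integrable) auto
qed

text \<open>Integration over \<open>t\<close> removes all mixed moments with
  \<open>k \<noteq> l\<close> by orthogonality, whatever the dependence between the
  \<open>Y k\<close>; each diagonal moment is at most \<open>A^2\<close>.\<close>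

lemma nn_integral_torus_trig_poly_le:
  fixes Y :: "nat ^ 'd \<Rightarrow> 'a \<Rightarrow> real"
  assumes meas: "\<And>k. k \<in> K \<Longrightarrow> Y k \<in> borel_measurable M"
    and bound: "\<And>k \<omega>. k \<in> K \<Longrightarrow> \<bar>Y k \<omega>\<bar> \<le> A"
    and "finite K"
  shows "(\<lambda>t. \<integral>\<^sup>+\<omega>. ennreal ((cmod (\<Sum>k\<in>K. cis (phase k t) * of_real (Y k \<omega>)))\<^sup>2) \<partial>M)
            \<in> borel_measurable borel" (is ?m)
    and "(\<integral>\<^sup>+t. indicator torus t *
            (\<integral>\<^sup>+\<omega>. ennreal ((cmod (\<Sum>k\<in>K. cis (phase k t) * of_real (Y k \<omega>)))\<^sup>2) \<partial>M) \<partial>lborel)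
         \<le> ennreal ((2 * pi) ^ CARD('d) * (real (card K) * A\<^sup>2))" (is ?i)
proof -
  \<comment> \<open>The inner expectation in closed form: a cosine sum in \<open>t\<close>, hence
    continuous.\<close>
  define h where "h = (\<lambda>t. \<Sum>k\<in>K. \<Sum>l\<in>K. cos (phase k t - phase l t) * expectation (\<lambda>\<omega>. Y k \<omega> * Y l \<omega>))"
  have h: "has_bochner_integral M (\<lambda>\<omega>. (cmod (\<Sum>k\<in>K. cis (phase k t) * of_real (Y k \<omega>)))\<^sup>2) (h t)" for t
    unfolding h_def using meas bound by (rule expectation_trig_poly_squared)
  \<comment> \<open>Nonnegativity is not visible termwise; it is inherited from the expectation of a
    square.\<close>
  have h_nonneg: "h t \<ge> 0" for t
    unfolding has_bochner_integral_integral_eq[OF h, symmetric] by simp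
  have eq: "(\<integral>\<^sup>+\<omega>. ennreal ((cmod (\<Sum>k\<in>K. cis (phase k t) * of_real (Y k \<omega>)))\<^sup>2) \<partial>M) = ennreal (h t)" for t
    using h[of t] by (subst nn_integral_eq_integral) (auto simp: has_bochner_integral_iff)
  have "h \<in> borel_measurable borel"
    unfolding h_def phase_def by (intro borel_measurable_continuous_onI continuous_intros)
  then show ?m unfolding eq by measurable
  have "has_bochner_integral lborel
      (\<lambda>t. \<Sum>k\<in>K. \<Sum>l\<in>K. indicator torus t * cos (phase k t - phase l t) * expectation (\<lambda>\<omega>. Y k \<omega> * Y l \<omega>))
      (\<Sum>k\<in>K. \<Sum>l\<in>K. (if k = l then (2 * pi) ^ CARD('d) else 0) * expectation (\<lambda>\<omega>. Y k \<omega> * Y l \<omega>))"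
    by (rule has_bochner_integral_sum, rule has_bochner_integral_sum,
        rule has_bochner_integral_mult_left, rule integral_cos_torus)
  moreover have "(\<Sum>k\<in>K. \<Sum>l\<in>K. indicator torus t * cos (phase k t - phase l t) * expectation (\<lambda>\<omega>. Y k \<omega> * Y l \<omega>))
      = indicator torus t * h t" for t
    by (simp only: h_def sum_distrib_left mult.assoc)
  moreover have "(\<Sum>k\<in>K. \<Sum>l\<in>K. (if k = l then (2 * pi) ^ CARD('d) else 0) * expectation (\<lambda>\<omega>. Y k \<omega> * Y l \<omega>))
      = (2 * pi) ^ CARD('d) * (\<Sum>k\<in>K. expectation (\<lambda>\<omega>. Y k \<omega> * Y k \<omega>))"
    unfolding sum_distrib_left
  proof (rule sum.cong)
    fix k assume "k \<in> K"
    with \<open>finite K\<close>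
    show "(\<Sum>l\<in>K. (if k = l then (2 * pi) ^ CARD('d) else 0) * expectation (\<lambda>\<omega>. Y k \<omega> * Y l \<omega>))
        = (2 * pi) ^ CARD('d) * expectation (\<lambda>\<omega>. Y k \<omega> * Y k \<omega>)"
      by (subst sum.mono_neutral_right[of K "{k}"]) auto
  qed simp
  ultimately have int: "has_bochner_integral lborel (\<lambda>t. indicator torus t * h t)
      ((2 * pi) ^ CARD('d) * (\<Sum>k\<in>K. expectation (\<lambda>\<omega>. Y k \<omega> * Y k \<omega>)))"
    by simp
  have "(\<integral>\<^sup>+t. ennreal (indicator torus t * h t) \<partial>lborel)
      = ennreal ((2 * pi) ^ CARD('d) * (\<Sum>k\<in>K. expectation (\<lambda>\<omega>. Y k \<omega> * Y k \<omega>)))"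
    using int h_nonneg by (subst nn_integral_eq_integral) (auto simp: has_bochner_integral_iff)
  moreover have "expectation (\<lambda>\<omega>. Y k \<omega> * Y k \<omega>) \<le> A\<^sup>2" if "k \<in> K" for k
  proof -
    have le: "Y k \<omega> * Y k \<omega> \<le> A\<^sup>2" for \<omega>
      using power_mono[OF bound[OF that, of \<omega>] abs_ge_zero, of 2] by (simp add: power2_eq_square)
    then show ?thesis
      by (intro integral_le_const integrable_const_bound[where B = "A\<^sup>2"] AE_I2
            borel_measurable_times meas[OF that]) simp_all
  qed
  then have "(\<Sum>k\<in>K. expectation (\<lambda>\<omega>. Y k \<omega> * Y k \<omega>)) \<le> real (card K) * A\<^sup>2"
    by (intro sum_bounded_above)
  then have "ennreal ((2 * pi) ^ CARD('d) * (\<Sum>k\<in>K. expectation (\<lambda>\<omega>. Y k \<omega> * Y k \<omega>)))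
      \<le> ennreal ((2 * pi) ^ CARD('d) * (real (card K) * A\<^sup>2))"
    by (intro ennreal_leI mult_left_mono) auto
  moreover have "indicator torus t * ennreal (h t) = ennreal (indicator torus t * h t)" for t
    by (simp add: indicator_def)
  ultimately show ?i unfolding eq by (simp only:)
qed

end

section \<open>Truncation and restriction to a grid of cubes\<close>

text \<open>Values beyond \<open>A\<close> become 0 rather than being clamped, so the truncation
  error is exactly \<open>|y|\<close> on the tail.\<close>

definition trunc :: "real \<Rightarrow> real \<Rightarrow> real" where
  "trunc A y = (if \<bar>y\<bar> \<le> A then y else 0)"

lemma abs_trunc_le: "A \<ge> 0 \<Longrightarrow> \<bar>trunc A y\<bar> \<le> A"
  by (simp add: trunc_def)

lemma abs_diff_trunc: "\<bar>y - trunc A y\<bar> = \<bar>y\<bar> * indicator {y. A < \<bar>y\<bar>} y"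
  by (simp add: trunc_def)

lemma trunc_measurable [measurable]: "trunc A \<in> borel_measurable borel"
  unfolding trunc_def by measurable

lemma DFT_cis: "DFT Y n t \<omega> = (\<Sum>k\<in>index_box n. cis (phase k t) * of_real (Y k \<omega>))"
  by (simp add: DFT_def cis_conv_exp)

lemma DFT_measurable [measurable]:
  assumes [measurable]: "\<And>k. k \<in> pos_lattice \<Longrightarrow> Y k \<in> borel_measurable M"
  shows "DFT Y n t \<in> borel_measurable M"
proof -
  have [measurable]: "Y k \<in> borel_measurable M" if "k \<in> index_box n" for k
    using that by (simp add: index_box_def)
  show ?thesis unfolding DFT_def[abs_def] by measurable
qed

text \<open>Three errors of size \<open>\<eta>\<close> add up: discarding the tails, rounding
  \<open>m\<close> down to a multiple of \<open>r\<close>, and the truncated sum at that multiple.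
  None of the bounds depends on \<open>m\<close>, which is what controls the maximum.\<close>

lemma cmod_DFT_le_grid:
  fixes Xs :: "nat ^ 'd \<Rightarrow> 'w \<Rightarrow> real"
  assumes "r > 0" "A \<ge> 0" "m \<le> n"
    and step: "real CARD('d) * real n ^ (CARD('d) - 1) * real r * A \<le> \<eta>"
    and tail: "(\<Sum>k\<in>index_box (cubic n). \<bar>Xs k \<omega>\<bar> * indicator {y. A < \<bar>y\<bar>} (Xs k \<omega>)) \<le> \<eta>"
    and grid: "\<And>j. j \<le> n div r \<Longrightarrow> cmod (DFT (\<lambda>k \<omega>. trunc A (Xs k \<omega>)) (cubic (r * j)) t \<omega>) \<le> \<eta>"
  shows "cmod (DFT Xs (cubic m) t \<omega>) \<le> 3 * \<eta>"
proof -
  \<comment> \<open>The largest multiple of \<open>r\<close> up to \<open>m\<close>; its index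
    \<open>m div r\<close> is at most \<open>n div r\<close>.\<close>
  define g where "g = r * (m div r)"
  define Y where "Y = (\<lambda>k \<omega>. trunc A (Xs k \<omega>))"
  have "g + m mod r = m" by (simp add: g_def)
  moreover have "m mod r < r" using \<open>r > 0\<close> by simp
  ultimately have g: "g \<le> m" "m \<le> g + r" by linarith+
  have norm_term: "cmod (cis a * of_real y) = \<bar>y\<bar>" for a y
    by (simp add: norm_mult)
  have "cmod (DFT Xs (cubic m) t \<omega> - DFT Y (cubic m) t \<omega>)
      = cmod (\<Sum>k\<in>index_box (cubic m). cis (phase k t) * of_real (Xs k \<omega> - Y k \<omega>))"
    by (simp add: DFT_cis algebra_simps sum_subtractf)
  also have "\<dots> \<le> (\<Sum>k\<in>index_box (cubic m). \<bar>Xs k \<omega>\<bar> * indicator {y. A < \<bar>y\<bar>} (Xs k \<omega>))"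
    by (rule sum_norm_le) (simp only: norm_term Y_def abs_diff_trunc order_refl)
  \<comment> \<open>Enlarging the box to that of \<open>n\<close> makes the tail bound uniform in
    \<open>m\<close>.\<close>
  also have "\<dots> \<le> (\<Sum>k\<in>index_box (cubic n). \<bar>Xs k \<omega>\<bar> * indicator {y. A < \<bar>y\<bar>} (Xs k \<omega>))"
    using \<open>m \<le> n\<close> by (intro sum_mono2 index_box_cubic_mono) auto
  also note tail
  finally have 1: "cmod (DFT Xs (cubic m) t \<omega> - DFT Y (cubic m) t \<omega>) \<le> \<eta>" .
  have "DFT Y (cubic m) t \<omega> - DFT Y (cubic g) t \<omega>
      = (\<Sum>k\<in>index_box (cubic m) - index_box (cubic g). cis (phase k t) * of_real (Y k \<omega>))"
    using index_box_cubic_mono[OF g(1), where 'd = 'd] by (simp add: DFT_cis sum_diff)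
  also have "cmod \<dots> \<le> real (card (index_box (cubic m :: nat ^ 'd) - index_box (cubic g))) * A"
    by (rule order_trans[OF sum_norm_le sum_bounded_above[where K = A]])
       (auto simp: norm_term Y_def abs_trunc_le \<open>A \<ge> 0\<close>)
  also have "\<dots> \<le> real CARD('d) * real n ^ (CARD('d) - 1) * real r * A"
    using g \<open>m \<le> n\<close> \<open>A \<ge> 0\<close> by (intro mult_right_mono card_index_box_shell)
  also note step
  finally have 2: "cmod (DFT Y (cubic m) t \<omega> - DFT Y (cubic g) t \<omega>) \<le> \<eta>" .
  have 3: "cmod (DFT Y (cubic g) t \<omega>) \<le> \<eta>"
    unfolding g_def Y_def using \<open>m \<le> n\<close> by (intro grid div_le_mono)
  have "DFT Xs (cubic m) t \<omega> = (DFT Xs (cubic m) t \<omega> - DFT Y (cubic m) t \<omega>)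
      + (DFT Y (cubic m) t \<omega> - DFT Y (cubic g) t \<omega>) + DFT Y (cubic g) t \<omega>"
    by simp
  also have "cmod \<dots> \<le> \<eta> + \<eta> + \<eta>"
    by (intro norm_triangle_mono 1 2 3)
  finally show ?thesis by simp
qed

context prob_space
begin

text \<open>If the tail sum and every grid value stay below \<open>\<eta>\<close>, the deterministic
  grid estimate bounds the maximum by \<open>3 * \<eta>\<close>. So the event is covered by one tail
  event, treated by Markov's inequality, and \<open>n div r + 1\<close> grid events, treated by
  second moments and a union bound.\<close>

lemma emeasure_max_DFT_le:
  fixes Xs :: "nat ^ 'd \<Rightarrow> 'a \<Rightarrow> real"
  assumes meas: "\<And>k. k \<in> pos_lattice \<Longrightarrow> Xs k \<in> borel_measurable M"
    and "r > 0" "A \<ge> 0" "n > 0" "\<eta> > 0"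
    and step: "real CARD('d) * real n ^ (CARD('d) - 1) * real r * A \<le> \<eta>"
  shows "emeasure M {\<omega> \<in> space M. (MAX m\<in>{1..n}. cmod (DFT Xs (cubic m) t \<omega>)) > 3 * \<eta>}
    \<le> ennreal (1 / \<eta>) * (\<Sum>k\<in>index_box (cubic n).
          \<integral>\<^sup>+\<omega>. ennreal \<bar>Xs k \<omega>\<bar> * indicator {\<omega>. A < \<bar>Xs k \<omega>\<bar>} \<omega> \<partial>M)
      + ennreal (1 / \<eta>\<^sup>2) * (\<Sum>j\<le>n div r.
          \<integral>\<^sup>+\<omega>. ennreal ((cmod (DFT (\<lambda>k \<omega>. trunc A (Xs k \<omega>)) (cubic (r * j)) t \<omega>))\<^sup>2) \<partial>M)"
proof -
  define V where "V = (\<lambda>\<omega>. \<Sum>k\<in>index_box (cubic n). \<bar>Xs k \<omega>\<bar> * indicator {y. A < \<bar>y\<bar>} (Xs k \<omega>))"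
  define Q where "Q = (\<lambda>j \<omega>. cmod (DFT (\<lambda>k \<omega>. trunc A (Xs k \<omega>)) (cubic (r * j)) t \<omega>))"
  note meas [measurable]
  have Xs [measurable]: "Xs k \<in> borel_measurable M" if "k \<in> index_box (cubic n)" for k
    using that by (simp add: index_box_def)
  have V [measurable]: "V \<in> borel_measurable M"
    unfolding V_def by measurable
  have Q [measurable]: "Q j \<in> borel_measurable M" for j
    unfolding Q_def by measurable
  have V_nonneg: "V \<omega> \<ge> 0" for \<omega>
    unfolding V_def by (intro sum_nonneg) auto
  \<comment> \<open>Exceedance is written as \<open>1 \<le> c * u\<close> in \<open>ennreal\<close>
    to fit the form of Markov's inequality.\<close>
  let ?EV = "{\<omega> \<in> space M. 1 \<le> ennreal (1 / \<eta>) * ennreal (V \<omega>)}"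
  let ?EQ = "\<lambda>j. {\<omega> \<in> space M. 1 \<le> ennreal (1 / \<eta>\<^sup>2) * ennreal ((Q j \<omega>)\<^sup>2)}"
  have "{\<omega> \<in> space M. (MAX m\<in>{1..n}. cmod (DFT Xs (cubic m) t \<omega>)) > 3 * \<eta>} \<subseteq> ?EV \<union> (\<Union>j\<le>n div r. ?EQ j)"
  proof (rule subsetI, rule ccontr)
    fix \<omega> assume \<omega>: "\<omega> \<in> {\<omega> \<in> space M. (MAX m\<in>{1..n}. cmod (DFT Xs (cubic m) t \<omega>)) > 3 * \<eta>}"
      and not: "\<omega> \<notin> ?EV \<union> (\<Union>j\<le>n div r. ?EQ j)"
    have "V \<omega> \<le> \<eta>"
      using \<omega> not \<open>\<eta> > 0\<close> V_nonneg[of \<omega>]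
      by (auto simp: not_le ennreal_less_one_iff simp flip: ennreal_mult)
    moreover have "Q j \<omega> \<le> \<eta>" if "j \<le> n div r" for j
    proof -
      have "(Q j \<omega>)\<^sup>2 \<le> \<eta>\<^sup>2"
        using \<omega> not \<open>\<eta> > 0\<close> that
        by (auto simp: not_le ennreal_less_one_iff intro: less_imp_le simp flip: ennreal_mult)
      then show ?thesis using \<open>\<eta> > 0\<close> by (simp add: power2_le_iff_abs_le)
    qed
    ultimately have "cmod (DFT Xs (cubic m) t \<omega>) \<le> 3 * \<eta>" if "m \<le> n" for m
      using that assms unfolding V_def Q_def by (intro cmod_DFT_le_grid) auto
    with \<omega> \<open>n > 0\<close> show False by (auto simp: Max_gr_iff Suc_le_eq not_less[symmetric])
  qed
  then have "emeasure M {\<omega> \<in> space M. (MAX m\<in>{1..n}. cmod (DFT Xs (cubic m) t \<omega>)) > 3 * \<eta>}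
      \<le> emeasure M (?EV \<union> (\<Union>j\<le>n div r. ?EQ j))"
    by (rule emeasure_mono) measurable
  also have "\<dots> \<le> emeasure M ?EV + emeasure M (\<Union>j\<le>n div r. ?EQ j)"
    by (rule emeasure_subadditive) measurable
  also have "\<dots> \<le> emeasure M ?EV + (\<Sum>j\<le>n div r. emeasure M (?EQ j))"
    by (intro add_left_mono emeasure_subadditive_finite) auto
  also have "\<dots> \<le> ennreal (1 / \<eta>) * (\<integral>\<^sup>+\<omega>. ennreal (V \<omega>) \<partial>M)
      + (\<Sum>j\<le>n div r. ennreal (1 / \<eta>\<^sup>2) * (\<integral>\<^sup>+\<omega>. ennreal ((Q j \<omega>)\<^sup>2) \<partial>M))"
    using nn_integral_Markov_inequality[of "\<lambda>\<omega>. ennreal (V \<omega>)" "space M" M "ennreal (1 / \<eta>)"]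
      nn_integral_Markov_inequality[of "\<lambda>\<omega>. ennreal ((Q _ \<omega>)\<^sup>2)" "space M" M "ennreal (1 / \<eta>\<^sup>2)"]
    by (intro add_mono sum_mono) (simp_all cong: nn_integral_cong)
  also have "(\<integral>\<^sup>+\<omega>. ennreal (V \<omega>) \<partial>M) = (\<Sum>k\<in>index_box (cubic n).
          \<integral>\<^sup>+\<omega>. ennreal \<bar>Xs k \<omega>\<bar> * indicator {\<omega>. A < \<bar>Xs k \<omega>\<bar>} \<omega> \<partial>M)"
  proof -
    have "ennreal (V \<omega>) = (\<Sum>k\<in>index_box (cubic n). ennreal \<bar>Xs k \<omega>\<bar> * indicator {\<omega>. A < \<bar>Xs k \<omega>\<bar>} \<omega>)" for \<omega>
      unfolding V_def by (subst sum_ennreal[symmetric]) (auto simp: indicator_def intro!: sum.cong)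
    then show ?thesis by (simp only:) (rule nn_integral_sum, measurable)
  qed
  finally show ?thesis by (simp add: Q_def sum_distrib_left)
qed

end

section \<open>Summation over n and the exceptional null set\<close>

lemma AE_suminf_finite:
  assumes [measurable]: "\<And>n. H n \<in> borel_measurable M" and "(\<Sum>n. \<integral>\<^sup>+x. H n x \<partial>M) < \<infinity>"
  shows "AE x in M. (\<Sum>n. H n x) < (\<infinity> :: ennreal)"
proof -
  have "(\<integral>\<^sup>+x. (\<Sum>n. H n x) \<partial>M) < \<infinity>"
    using assms by (simp add: nn_integral_suminf)
  then have "AE x in M. (\<Sum>n. H n x) \<noteq> \<infinity>"
    by (intro nn_integral_PInf_AE) auto
  then show ?thesis by (simp add: top.not_eq_extremum)
qed

text \<open>With \<open>r = floor_sqrt n\<close>, the chain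
  \<open>sqrt n < r + 1 \<le> 2 * r\<close> gives \<open>n / r \<le> 2 * sqrt n\<close>; this bounds
  the number of grid points.\<close>

lemma div_floor_sqrt_le:
  assumes "n > 0"
  shows "real (n div floor_sqrt n) \<le> 2 * sqrt (real n)"
proof -
  let ?r = "floor_sqrt n"
  have r: "1 \<le> ?r" using assms by (simp add: Suc_le_eq)
  have "n < (Suc ?r)\<^sup>2" by (rule Suc_floor_sqrt_power2_gt)
  then have "real n < (real ?r + 1)\<^sup>2"
    by (metis of_nat_Suc of_nat_less_iff of_nat_power add.commute)
  then have "sqrt (real n) < real ?r + 1" by (simp add: real_less_lsqrt)
  then have s: "sqrt (real n) \<le> 2 * real ?r" using r by linarith
  have "real (n div ?r) \<le> real n / real ?r" by (rule of_nat_div_le_of_nat)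
  also have "\<dots> \<le> 2 * sqrt (real n)"
  proof -
    have "real n = sqrt (real n) * sqrt (real n)" by simp
    also have "\<dots> \<le> sqrt (real n) * (2 * real ?r)" by (intro mult_left_mono s) simp
    finally show ?thesis using r assms by (subst pos_divide_le_eq) (auto simp: mult_ac)
  qed
  finally show ?thesis .
qed

theorem theorem3p5:
  fixes P :: "'w measure"
    and X :: "'w \<Rightarrow> real"
    and Xs :: "nat ^ 'd \<Rightarrow> 'w \<Rightarrow> real"
    and M :: real
  assumes "prob_space P"
    and "X \<in> borel_measurable P"
    and "\<And>n. n \<in> pos_lattice \<Longrightarrow> Xs n \<in> borel_measurable P"
    and "M > 0"
    and "\<And>x n. x \<ge> 0 \<Longrightarrow> n \<in> pos_lattice \<Longrightarrow>
           1 / real (index_size n) *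
             (\<Sum>k\<in>index_box n. measure P {\<omega> \<in> space P. \<bar>Xs k \<omega>\<bar> > x})
           \<le> M * measure P {\<omega> \<in> space P. \<bar>X \<omega>\<bar> > x}"
    and "integrable P (\<lambda>\<omega>. \<bar>X \<omega>\<bar> * log_plus \<bar>X \<omega>\<bar>)"
  shows "\<forall>\<epsilon>>0. AE t in lebesgue. t \<in> (torus :: (real ^ 'd) set) \<longrightarrow>
           (\<lambda>n. real (index_size (cubic n :: nat ^ 'd)) powr (- 1 / real CARD('d)) *
                measure P {\<omega> \<in> space P.
                  (MAX m\<in>{1..n}. cmod (DFT Xs (cubic m) t \<omega>))
                    > \<epsilon> * real (index_size (cubic n :: nat ^ 'd))})
           summable_on {1..}"
proof (intro allI impI)
  fix \<epsilon> :: real assume \<epsilon>: "\<epsilon> > 0"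
  interpret prob_space P by fact
  note X [measurable] = assms(2) and Xs = assms(3)
  let ?d = "CARD('d)"
  \<comment> \<open>The exponent 1/8 meets two demands: with grid width about \<open>sqrt n\<close>,
    rounding costs order \<open>n^(d - 3/8)\<close>, below \<open>n^d\<close>, while the weighted
    second moments are of order \<open>n^(-d - 1/4)\<close>, summable even for
    \<open>d = 1\<close>.\<close>
  define A where "A = (\<lambda>n::nat. real n powr (1 / 8))"
  \<comment> \<open>One third of the threshold, because the grid estimate adds three errors
    \<open>\<eta>\<close>.\<close>
  define \<eta> where "\<eta> = (\<lambda>n::nat. \<epsilon> * real n ^ ?d / 3)"
  define T where "T = (\<lambda>n. \<integral>\<^sup>+\<omega>. ennreal \<bar>X \<omega>\<bar> * indicator {\<omega>. A n < \<bar>X \<omega>\<bar>} \<omega> \<partial>P)"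
  define Y where "Y = (\<lambda>n k \<omega>. trunc (A n) (Xs k \<omega>))"
  define G where "G = (\<lambda>n j (t :: real ^ 'd).
      \<integral>\<^sup>+\<omega>. ennreal ((cmod (DFT (Y n) (cubic (floor_sqrt n * j)) t \<omega>))\<^sup>2) \<partial>P)"
  \<comment> \<open>The grid part of the bound for term \<open>n\<close>, including the weight
    \<open>1 / n\<close>. The indicator turns integration over the whole space into integration over
    the torus.\<close>
  define H where "H = (\<lambda>n t. ennreal (1 / real n * (1 / (\<eta> n)\<^sup>2)) *
      (\<Sum>j\<le>n div floor_sqrt n. indicator torus t * G n j t))"
  define f where "f = (\<lambda>t n. real (index_size (cubic n :: nat ^ 'd)) powr (- 1 / real ?d) *
      prob {\<omega> \<in> space P. (MAX m\<in>{1..n}. cmod (DFT Xs (cubic m) t \<omega>))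
                > \<epsilon> * real (index_size (cubic n :: nat ^ 'd))})"

  have A_nonneg: "A n \<ge> 0" for n by (simp add: A_def)
  have Y_meas: "Y n k \<in> borel_measurable P" if "k \<in> index_box m" for n k m
    using Xs[of k] that unfolding Y_def by (auto simp: index_box_def)
  have Y_bound: "\<bar>Y n k \<omega>\<bar> \<le> A n" for n k \<omega>
    unfolding Y_def by (intro abs_trunc_le A_nonneg)
  have G_meas [measurable]: "G n j \<in> borel_measurable borel" for n j
    unfolding G_def DFT_cis
    by (rule nn_integral_torus_trig_poly_le(1)[OF Y_meas Y_bound finite_index_box_cubic])
  have G_int: "(\<integral>\<^sup>+t. indicator torus t * G n j t \<partial>lborel)
      \<le> ennreal ((2 * pi) ^ ?d * (real n ^ ?d * (A n)\<^sup>2))" if "j \<le> n div floor_sqrt n" for n j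
  proof -
    \<comment> \<open>Every grid point is at most \<open>n\<close>, so its box has at most
      \<open>n^d\<close> elements.\<close>
    have "floor_sqrt n * j \<le> floor_sqrt n * (n div floor_sqrt n)"
      using that by (rule mult_left_mono) simp
    also have "\<dots> \<le> n" by simp
    finally have *: "real (floor_sqrt n * j) ^ ?d \<le> real n ^ ?d"
      by (intro power_mono) (auto simp del: of_nat_mult)
    have "(\<integral>\<^sup>+t. indicator torus t * G n j t \<partial>lborel)
        \<le> ennreal ((2 * pi) ^ ?d * (real (card (index_box (cubic (floor_sqrt n * j) :: nat ^ 'd))) * (A n)\<^sup>2))"
      unfolding G_def DFT_cis
      by (rule nn_integral_torus_trig_poly_le(2)[OF Y_meas Y_bound finite_index_box_cubic])
    also have "\<dots> \<le> ennreal ((2 * pi) ^ ?d * (real n ^ ?d * (A n)\<^sup>2))"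
      using * by (intro ennreal_leI mult_left_mono mult_right_mono) (auto simp: card_index_box_cubic)
    finally show ?thesis .
  qed

  have H_int: "(\<integral>\<^sup>+t. H n t \<partial>lborel) \<le> ennreal (27 * (2 * pi) ^ ?d / \<epsilon>\<^sup>2 * real n powr (- 5 / 4))" for n
  proof (cases "n = 0")
    case True
    \<comment> \<open>With \<open>1 / 0 = 0\<close> the weight in \<open>H 0\<close>
      vanishes.\<close>
    then show ?thesis by (simp add: H_def)
  next
    case False
    let ?N = "n div floor_sqrt n"
    let ?c = "(2 * pi) ^ ?d * (real n ^ ?d * (A n)\<^sup>2)"
    have n: "real n \<ge> 1" using False by simp
    have "(\<integral>\<^sup>+t. H n t \<partial>lborel) = ennreal (1 / real n * (1 / (\<eta> n)\<^sup>2)) *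
        (\<Sum>j\<le>?N. \<integral>\<^sup>+t. indicator torus t * G n j t \<partial>lborel)"
      unfolding H_def by (subst nn_integral_cmult, measurable) (subst nn_integral_sum, auto)
    also have "\<dots> \<le> ennreal (1 / real n * (1 / (\<eta> n)\<^sup>2)) * (\<Sum>j\<le>?N. ennreal ?c)"
      by (intro mult_left_mono sum_mono G_int) auto
    also have "(\<Sum>j\<le>?N. ennreal ?c) = ennreal ((real ?N + 1) * ?c)"
      by (subst sum_ennreal) (auto simp: add.commute)
    also have "ennreal (1 / real n * (1 / (\<eta> n)\<^sup>2)) * \<dots> = ennreal (1 / real n * (1 / (\<eta> n)\<^sup>2) * ((real ?N + 1) * ?c))"
      by (subst ennreal_mult[symmetric]) auto
    also have "1 / real n * (1 / (\<eta> n)\<^sup>2) * ((real ?N + 1) * ?c)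
        \<le> 1 / real n * (1 / (\<eta> n)\<^sup>2) * ((3 * sqrt (real n)) * ?c)"
    proof -
      \<comment> \<open>The extra 1 counts \<open>j = 0\<close> and is absorbed because
        \<open>sqrt n \<ge> 1\<close>.\<close>
      have "1 \<le> sqrt (real n)" using n by simp
      then have "real ?N + 1 \<le> 3 * sqrt (real n)"
        using div_floor_sqrt_le[of n] False by linarith
      then show ?thesis by (intro mult_left_mono mult_right_mono) auto
    qed
    \<comment> \<open>The constant 27 is 3 from the grid count times 9 from
      \<open>(\<epsilon> / 3)^2\<close> in \<open>\<eta>\<close>. The exponents combine as
      \<open>1/2 + 1/4 - 1 = -1/4\<close> and \<open>d - 2 * d = - d\<close>.\<close>
    also have "\<dots> = 27 * (2 * pi) ^ ?d / \<epsilon>\<^sup>2 * (real n powr (- 1 / 4) / real n ^ ?d)"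
    proof -
      have "sqrt (real n) * (A n)\<^sup>2 = real n powr (1 / 2) * real n powr (1 / 4)"
        using n by (simp add: A_def powr_half_sqrt powr_power)
      also have "\<dots> = real n powr (- 1 / 4 + 1)"
        by (simp flip: powr_add)
      also have "\<dots> = real n powr (- 1 / 4) * real n"
        using n by (subst powr_add) simp
      finally have e: "sqrt (real n) * (A n)\<^sup>2 = real n powr (- 1 / 4) * real n" .
      have "1 / real n * (1 / (\<eta> n)\<^sup>2) * ((3 * sqrt (real n)) * ?c)
          = 1 / real n * (1 / (\<eta> n)\<^sup>2) * 3 * (2 * pi) ^ ?d * real n ^ ?d * (sqrt (real n) * (A n)\<^sup>2)"
        by (simp add: mult_ac)
      also have "\<dots> = 27 * (2 * pi) ^ ?d / \<epsilon>\<^sup>2 * (real n powr (- 1 / 4) / real n ^ ?d)"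
        unfolding e using n \<epsilon> by (simp add: \<eta>_def power2_eq_square field_simps)
      finally show ?thesis .
    qed
    \<comment> \<open>As \<open>d \<ge> 1\<close>, the factor \<open>1 / n^d\<close> is at most
      \<open>1 / n\<close>, giving the exponent -5/4.\<close>
    also have "\<dots> \<le> 27 * (2 * pi) ^ ?d / \<epsilon>\<^sup>2 * (real n powr (- 1 / 4) / real n)"
      using n power_increasing[of 1 ?d "real n"]
      by (intro mult_left_mono divide_left_mono) (auto simp: Suc_le_eq)
    also have "real n powr (- 1 / 4) / real n = real n powr (- 1 / 4 - 1)"
      using n powr_diff[of "real n" "- 1 / 4" 1] by simp
    finally show ?thesis by (simp add: ennreal_leI)
  qed
  have "summable (\<lambda>n. 27 * (2 * pi) ^ ?d / \<epsilon>\<^sup>2 * real n powr (- 5 / 4))"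
    by (intro summable_mult) (simp add: summable_real_powr_iff)
  then have "(\<Sum>n. ennreal (27 * (2 * pi) ^ ?d / \<epsilon>\<^sup>2 * real n powr (- 5 / 4))) < \<infinity>"
    by (subst suminf_ennreal2) auto
  moreover have "(\<Sum>n. \<integral>\<^sup>+t. H n t \<partial>lborel)
      \<le> (\<Sum>n. ennreal (27 * (2 * pi) ^ ?d / \<epsilon>\<^sup>2 * real n powr (- 5 / 4)))"
    by (intro suminf_le H_int) auto
  ultimately have H_sum: "AE t in lborel. (\<Sum>n. H n t) < \<infinity>"
    by (intro AE_suminf_finite) (auto simp: H_def intro: le_less_trans)

  \<comment> \<open>This series does not depend on \<open>t\<close>, so it adds no exceptional
    set.\<close>
  have T_sum: "(\<Sum>n. ennreal (1 / real n) * T n) < \<infinity>"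
    unfolding T_def A_def using X _ assms(6) by (rule nn_integral_log_tail_finite) simp
  \<comment> \<open>The domination hypothesis at the cubic index, multiplied through by
    \<open>n^d\<close>; \<open>n > 0\<close> puts the index in \<open>pos_lattice\<close> and makes
    its size nonzero.\<close>
  have tail: "(\<Sum>k\<in>index_box (cubic n). \<integral>\<^sup>+\<omega>. ennreal \<bar>Xs k \<omega>\<bar> * indicator {\<omega>. A n < \<bar>Xs k \<omega>\<bar>} \<omega> \<partial>P)
      \<le> ennreal (M * real n ^ ?d) * T n" if "n > 0" for n
    unfolding T_def
  proof (rule sum_tail_expectation_le)
    fix x :: real assume "x \<ge> 0"
    moreover have "(cubic n :: nat ^ 'd) \<in> pos_lattice"
      using that by (simp add: pos_lattice_def cubic_def Suc_le_eq)
    ultimately show "(\<Sum>k\<in>index_box (cubic n). prob {\<omega> \<in> space P. \<bar>Xs k \<omega>\<bar> > x})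
        \<le> M * real n ^ ?d * prob {\<omega> \<in> space P. \<bar>X \<omega>\<bar> > x}"
      using assms(5)[of x "cubic n"] that by (simp add: index_size_cubic field_simps)
  qed (use Xs \<open>M > 0\<close> A_nonneg in \<open>auto simp: index_box_def\<close>)

  \<comment> \<open>For \<open>n > 0\<close> this says that
    \<open>d * n^(d - 1) * n^(1/2) * n^(1/8)\<close>, an upper bound for the rounding cost, is at
    most \<open>\<epsilon> * n^d / 3\<close>; here \<open>3/8 = 1 - 1/2 - 1/8\<close>.\<close>
  have "\<forall>\<^sub>F n in sequentially. 3 * real ?d / \<epsilon> \<le> real n powr (3 / 8)"
    by real_asymp
  then obtain n0 where n0: "\<And>n. n \<ge> n0 \<Longrightarrow> 3 * real ?d / \<epsilon> \<le> real n powr (3 / 8)"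
    by (auto simp: eventually_sequentially)
  have step: "real ?d * real n ^ (?d - 1) * real (floor_sqrt n) * A n \<le> \<eta> n" if "n \<ge> n0" "n > 0" for n
  proof -
    have "(real (floor_sqrt n))\<^sup>2 \<le> real n"
      by (metis floor_sqrt_power2_le of_nat_le_iff of_nat_power)
    then have "real (floor_sqrt n) \<le> real n powr (1 / 2)"
      by (simp add: powr_half_sqrt real_le_rsqrt)
    then have "real (floor_sqrt n) * A n \<le> real n powr (1 / 2) * real n powr (1 / 8)"
      unfolding A_def by (intro mult_right_mono) auto
    also have "\<dots> = real n powr (5 / 8)"
      by (simp flip: powr_add)
    finally have "real ?d * (real (floor_sqrt n) * A n) \<le> (\<epsilon> / 3 * real n powr (3 / 8)) * real n powr (5 / 8)"
      using n0[OF that(1)] \<epsilon> by (intro mult_mono) (auto simp: field_simps A_def)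
    also have "\<dots> = \<epsilon> / 3 * real n"
      using that by (simp flip: powr_add)
    finally have "real n ^ (?d - 1) * (real ?d * (real (floor_sqrt n) * A n)) \<le> real n ^ (?d - 1) * (\<epsilon> / 3 * real n)"
      by (intro mult_left_mono) auto
    also have "\<dots> = \<eta> n"
      using power_minus_mult[of ?d "real n"] by (simp add: \<eta>_def mult_ac)
    finally show ?thesis by (simp add: mult_ac)
  qed

  have f_le: "ennreal (f t n) \<le> ennreal (3 * M / \<epsilon>) * (ennreal (1 / real n) * T n) + H n t"
    if "t \<in> torus" "n \<ge> n0" "n > 0" for t n
  proof -
    have \<eta>: "\<eta> n > 0" using \<epsilon> that by (simp add: \<eta>_def)
    have "ennreal (f t n) = ennreal (1 / real n) *
        emeasure P {\<omega> \<in> space P. (MAX m\<in>{1..n}. cmod (DFT Xs (cubic m) t \<omega>)) > 3 * \<eta> n}"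
    proof -
      have "real (index_size (cubic n :: nat ^ 'd)) powr (- 1 / real ?d) = 1 / real n"
        using that by (simp add: index_size_cubic powr_powr powr_minus_divide flip: powr_realpow)
      moreover have "\<epsilon> * real (index_size (cubic n :: nat ^ 'd)) = 3 * \<eta> n"
        by (simp add: \<eta>_def index_size_cubic)
      ultimately show ?thesis
        unfolding f_def emeasure_eq_measure by (simp only:) (rule ennreal_mult, auto)
    qed
    also have "\<dots> \<le> ennreal (1 / real n) * (ennreal (1 / \<eta> n) * (ennreal (M * real n ^ ?d) * T n)
        + ennreal (1 / (\<eta> n)\<^sup>2) * (\<Sum>j\<le>n div floor_sqrt n. G n j t))"
    proof (rule mult_left_mono[OF order_trans[OF emeasure_max_DFT_le]])
      show "ennreal (1 / \<eta> n) * (\<Sum>k\<in>index_box (cubic n).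
              \<integral>\<^sup>+\<omega>. ennreal \<bar>Xs k \<omega>\<bar> * indicator {\<omega>. A n < \<bar>Xs k \<omega>\<bar>} \<omega> \<partial>P)
          + ennreal (1 / (\<eta> n)\<^sup>2) * (\<Sum>j\<le>n div floor_sqrt n.
              \<integral>\<^sup>+\<omega>. ennreal ((cmod (DFT (\<lambda>k \<omega>. trunc (A n) (Xs k \<omega>)) (cubic (floor_sqrt n * j)) t \<omega>))\<^sup>2) \<partial>P)
          \<le> ennreal (1 / \<eta> n) * (ennreal (M * real n ^ ?d) * T n)
          + ennreal (1 / (\<eta> n)\<^sup>2) * (\<Sum>j\<le>n div floor_sqrt n. G n j t)"
        unfolding G_def Y_def using that by (intro add_mono mult_left_mono tail order_refl) auto
    qed (use Xs that \<eta> A_nonneg step in auto)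
    also have "\<dots> = ennreal (3 * M / \<epsilon>) * (ennreal (1 / real n) * T n) + H n t"
    proof -
      have "ennreal (1 / real n) * (ennreal (1 / \<eta> n) * (ennreal (M * real n ^ ?d) * T n))
          = ennreal (1 / \<eta> n * (M * real n ^ ?d)) * (ennreal (1 / real n) * T n)"
        using \<eta> \<open>M > 0\<close> by (subst ennreal_mult) (auto simp: mult_ac)
      \<comment> \<open>The powers of \<open>n\<close> cancel: a tail bound of order
        \<open>n^d\<close> meets a threshold of order \<open>n^d\<close>, so only the weight
        \<open>1 / n\<close> stays with \<open>T n\<close>.\<close>
      moreover have "1 / \<eta> n * (M * real n ^ ?d) = 3 * M / \<epsilon>"
        using \<epsilon> that by (simp add: \<eta>_def)
      moreover have "ennreal (1 / real n) * (ennreal (1 / (\<eta> n)\<^sup>2) * (\<Sum>j\<le>n div floor_sqrt n. G n j t)) = H n t"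
        using that by (subst H_def, subst ennreal_mult) (auto simp: mult_ac)
      ultimately show ?thesis by (simp add: distrib_left)
    qed
    finally show ?thesis .
  qed

  \<comment> \<open>The exceptional null set comes from the grid series \<open>H\<close>
    alone.\<close>
  have "AE t in lborel. t \<in> torus \<longrightarrow> f t summable_on {1..}"
    using H_sum
  proof eventually_elim
    fix t assume t: "(\<Sum>n. H n t) < \<infinity>"
    show "t \<in> torus \<longrightarrow> f t summable_on {1..}"
    proof
      assume "t \<in> torus"
      \<comment> \<open>The finitely many initial terms, where the rounding cost is not yet
        controlled, are set to zero; summability is unaffected.\<close>
      define g where "g = (\<lambda>n. if n0 \<le> n \<and> 0 < n then f t n else 0)"
      have f_nonneg: "f t n \<ge> 0" for n by (simp add: f_def)
      have "(\<Sum>n. ennreal (g n)) \<le> (\<Sum>n. ennreal (3 * M / \<epsilon>) * (ennreal (1 / real n) * T n) + H n t)"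
        using f_le[OF \<open>t \<in> torus\<close>] by (intro suminf_le) (auto simp: g_def)
      also have "\<dots> = ennreal (3 * M / \<epsilon>) * (\<Sum>n. ennreal (1 / real n) * T n) + (\<Sum>n. H n t)"
        by (subst suminf_add[symmetric]) auto
      also have "\<dots> < \<infinity>"
        using t T_sum by (simp add: ennreal_mult_less_top)
      finally have "summable g"
        by (intro summable_suminf_not_top) (auto simp: g_def f_nonneg)
      moreover have "\<forall>\<^sub>F n in sequentially. g n = f t n"
        using eventually_ge_at_top[of "Suc n0"] by eventually_elim (auto simp: g_def)
      ultimately have "summable (f t)"
        by (simp add: summable_cong)
      \<comment> \<open>For nonnegative terms convergence of the series is unconditional, and then
        passes to subsets.\<close>
      then have "f t summable_on UNIV"
        by (rule summable_nonneg_imp_summable_on) (rule f_nonneg)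
      then show "f t summable_on {1..}"
        by (rule summable_on_subset_banach) simp
    qed
  qed
  then show "AE t in lebesgue. t \<in> (torus :: (real ^ 'd) set) \<longrightarrow>
      (\<lambda>n. real (index_size (cubic n :: nat ^ 'd)) powr (- 1 / real ?d) *
          prob {\<omega> \<in> space P. (MAX m\<in>{1..n}. cmod (DFT Xs (cubic m) t \<omega>))
                > \<epsilon> * real (index_size (cubic n :: nat ^ 'd))}) summable_on {1..}"
    \<comment> \<open>\<open>lebesgue\<close> is the completion of \<open>lborel\<close>, so
      almost-everywhere statements carry over.\<close>
    unfolding f_def by (rule AE_completion)
qed

end
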